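(* Let $n\geq 1$, let $\mathcal G_n$ be the set of isomorphism classes of graphs with exactly $n$ edges, and let $\Gamma_{n,n-1}$ be the category with covering families defined in the context. Then the edge reconstruction conjecture is true for graphs with $n$ edges (that is, for all graphs $G,G'$ with $n$ edges, $\mathrm{ED}(G)=\mathrm{ED}(G')$ implies $G\cong G'$) if and only if the map $$\iota_n\colon \mathcal G_n\to K_0(\Gamma_{n,n-1}),\qquad [G]\mapsto [G],$$ is injective.
   Context: Graphs: a (finite) graph is a pair of finite sets $(V,E)$ with an injective function $\partial\colon E\to \mathrm{Pair}(V)$, where $\mathrm{Pair}(V)$ is the set of unordered pairs of distinct elements of $V$. A morphism of graphs is a pair of injective maps $f_V\colon V\to V'$, $f_E\colon E\to E'$ with $\partial' f_E(e)=f_V(\partial e)$ for all $e\in E$. For $e\in E$, $G-e$ denotes the graph with vertex set $V$ and edge set $E\setminus\{e\}$. The edge deck $\mathrm{ED}(G)$ is the multiset of isomorphism classes of the graphs $G-e$, $e\in E$; its elements are called cards. Categories with covering families: a small category $\mathscr C$ with a distinguished object $*$ such that $\mathscr C( *,* )=\{1_*\}$ and $\mathscr C(c,* )=\varnothing$ for $c\ne *$, together with a collection of finite (possibly empty) families of morphisms with common target, called covering families, such that: $\{*=*\}_{i\in I}$ is a covering family for every finite (possibly empty) set $I$; $\{c=c\}$ is a covering family for every object $c$; and covering families are closed under composition (if $\{g_j\colon B_j\to A\}_{j\in J}$ and, for each $j$, $\{f_{ij}\colon C_{ij}\to B_j\}_{i\in I_j}$ are covering families, so is $\{g_jf_{ij}\}_{j\in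 J,i\in I_j}$). The group $K_0(\mathscr C)$ is the abelian group generated by symbols $[A]$ for $A\in \mathrm{Ob}\,\mathscr C$, with relations $[A]=\sum_{i\in I}[A_i]$ for every covering family $\{A_i\to A\}_{i\in I}$. The category $\Gamma_{n,n-1}$: the full subcategory of the category of graphs on the graphs with exactly $n$ or $n-1$ edges together with the empty graph $\varnothing$, which is the distinguished object. Its covering families are: (i) $\{\varnothing=\varnothing\}_{i\in I}$ for every finite (possibly empty) set $I$; (ii) $\{f\colon G\to G'\}$ for every isomorphism $f$; (iii) for every graph $G$ with $n$ edges, writing $C_1,\dots,C_n$ for the $n$ edge-deleted subgraphs of $G$ and $i_j\colon C_j\to G$ for the inclusions, every family $\{f_j\colon C_j'\to G\}_{j=1}^n$ with $f_j=i_j\circ g_j$ for some isomorphisms $g_j\colon C_j'\to C_j$ (the order of indexing is immaterial). *)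

theory Defs
  imports
    "HOL-Algebra.Free_Abelian_Groups"
    "HOL-Library.FuncSet"
    "HOL-Library.Multiset"
    "HOL-Library.Infinite_Typeclass"
begin

section \<open>Graphs\<close>

record ('v, 'e) graph =
  verts :: "'v set"
  edges :: "'e set"
  ends  :: "'e \<Rightarrow> 'v set"

definition Pairs :: "'v set \<Rightarrow> 'v set set"
  where "Pairs V = {{u, v} | u v. u \<in> V \<and> v \<in> V \<and> u \<noteq> v}"

text \<open>Incidence functions, and below the components of morphisms, are required to be extensional
  (\<open>undefined\<close> outside of their domain), so that equality in HOL is equality of graphs and
  of morphisms.\<close>

definition is_graph :: "('v, 'e) graph \<Rightarrow> bool"
  where "is_graph G \<longleftrightarrow> finite (verts G) \<and> finite (edges G) \<and>
    ends G \<in> edges G \<rightarrow>\<^sub>E Pairs (verts G) \<and> inj_on (ends G) (edges G)"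

definition empty_graph :: "('v, 'e) graph"
  where "empty_graph = \<lparr>verts = {}, edges = {}, ends = (\<lambda>_. undefined)\<rparr>"

definition graphs_with :: "nat \<Rightarrow> ('v, 'e) graph set"
  where "graphs_with n = {G. is_graph G \<and> card (edges G) = n}"

definition delete_edge :: "('v, 'e) graph \<Rightarrow> 'e \<Rightarrow> ('v, 'e) graph"
  where "delete_edge G e =
    \<lparr>verts = verts G, edges = edges G - {e}, ends = restrict (ends G) (edges G - {e})\<rparr>"

record ('v, 'e) morph =
  src  :: "('v, 'e) graph"
  tgt  :: "('v, 'e) graph"
  vmap :: "'v \<Rightarrow> 'v"
  emap :: "'e \<Rightarrow> 'e"

definition is_morph :: "('v, 'e) morph \<Rightarrow> bool"
  where "is_morph f \<longleftrightarrow> is_graph (src f) \<and> is_graph (tgt f) \<and>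
    vmap f \<in> verts (src f) \<rightarrow>\<^sub>E verts (tgt f) \<and> inj_on (vmap f) (verts (src f)) \<and>
    emap f \<in> edges (src f) \<rightarrow>\<^sub>E edges (tgt f) \<and> inj_on (emap f) (edges (src f)) \<and>
    (\<forall>e \<in> edges (src f). ends (tgt f) (emap f e) = vmap f ` ends (src f) e)"

definition id_morph :: "('v, 'e) graph \<Rightarrow> ('v, 'e) morph"
  where "id_morph G =
    \<lparr>src = G, tgt = G, vmap = (\<lambda>v\<in>verts G. v), emap = (\<lambda>e\<in>edges G. e)\<rparr>"

definition comp_morph :: "('v, 'e) morph \<Rightarrow> ('v, 'e) morph \<Rightarrow> ('v, 'e) morph"
  where "comp_morph g f = \<lparr>src = src f, tgt = tgt g,
    vmap = compose (verts (src f)) (vmap g) (vmap f),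
    emap = compose (edges (src f)) (emap g) (emap f)\<rparr>"

definition is_graph_iso :: "('v, 'e) morph \<Rightarrow> bool"
  where "is_graph_iso f \<longleftrightarrow> is_morph f \<and>
    (\<exists>g. is_morph g \<and> src g = tgt f \<and> tgt g = src f \<and>
      comp_morph g f = id_morph (src f) \<and> comp_morph f g = id_morph (tgt f))"

definition isomorphic :: "('v, 'e) graph \<Rightarrow> ('v, 'e) graph \<Rightarrow> bool"
  where "isomorphic G H \<longleftrightarrow> (\<exists>f. is_graph_iso f \<and> src f = G \<and> tgt f = H)"

definition iso_class :: "('v, 'e) graph \<Rightarrow> ('v, 'e) graph set"
  where "iso_class G = {H. isomorphic G H}"

definition iso_classes :: "nat \<Rightarrow> ('v, 'e) graph set set"
  where "iso_classes n = iso_class ` graphs_with n"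

definition edge_deck :: "('v, 'e) graph \<Rightarrow> ('v, 'e) graph set multiset"
  where "edge_deck G = {#iso_class (delete_edge G e). e \<in># mset_set (edges G)#}"

definition deletion_inclusion :: "('v, 'e) graph \<Rightarrow> 'e \<Rightarrow> ('v, 'e) morph"
  where "deletion_inclusion G e = \<lparr>src = delete_edge G e, tgt = G,
    vmap = (\<lambda>v\<in>verts G. v), emap = (\<lambda>x\<in>edges G - {e}. x)\<rparr>"


section \<open>Categories with covering families\<close>

text \<open>A finite family of morphisms with common target \<open>A\<close>, up to reindexing, is a pair of
  \<open>A\<close> and a finite multiset of morphisms into \<open>A\<close>. The target is recorded separately
  because it cannot be recovered from an empty family.\<close>

record ('o, 'm) cov_cat =
  Obj  :: "'o set"
  Arr  :: "'m set"
  Dom  :: "'m \<Rightarrow> 'o"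
  Cod  :: "'m \<Rightarrow> 'o"
  Id   :: "'o \<Rightarrow> 'm"
  Comp :: "'m \<Rightarrow> 'm \<Rightarrow> 'm"
  Pt   :: "'o"
  Cov  :: "('o \<times> 'm multiset) set"

locale category_with_covering_families =
  fixes C :: "('o, 'm) cov_cat"
  assumes Dom_Obj: "f \<in> Arr C \<Longrightarrow> Dom C f \<in> Obj C"
    and Cod_Obj: "f \<in> Arr C \<Longrightarrow> Cod C f \<in> Obj C"
    and Id_Arr: "A \<in> Obj C \<Longrightarrow> Id C A \<in> Arr C"
    and Dom_Id: "A \<in> Obj C \<Longrightarrow> Dom C (Id C A) = A"
    and Cod_Id: "A \<in> Obj C \<Longrightarrow> Cod C (Id C A) = A"
    and Comp_Arr: "\<lbrakk>f \<in> Arr C; g \<in> Arr C; Cod C f = Dom C g\<rbrakk> \<Longrightarrow> Comp C g f \<in> Arr C"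
    and Dom_Comp: "\<lbrakk>f \<in> Arr C; g \<in> Arr C; Cod C f = Dom C g\<rbrakk> \<Longrightarrow> Dom C (Comp C g f) = Dom C f"
    and Cod_Comp: "\<lbrakk>f \<in> Arr C; g \<in> Arr C; Cod C f = Dom C g\<rbrakk> \<Longrightarrow> Cod C (Comp C g f) = Cod C g"
    and Comp_Id_left: "f \<in> Arr C \<Longrightarrow> Comp C (Id C (Cod C f)) f = f"
    and Comp_Id_right: "f \<in> Arr C \<Longrightarrow> Comp C f (Id C (Dom C f)) = f"
    and Comp_assoc: "\<lbrakk>f \<in> Arr C; g \<in> Arr C; h \<in> Arr C; Cod C f = Dom C g; Cod C g = Dom C h\<rbrakk>
      \<Longrightarrow> Comp C h (Comp C g f) = Comp C (Comp C h g) f"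
    and Pt_Obj: "Pt C \<in> Obj C"
    and Hom_Pt_Pt: "{f \<in> Arr C. Dom C f = Pt C \<and> Cod C f = Pt C} = {Id C (Pt C)}"
    and Hom_Pt: "\<lbrakk>A \<in> Obj C; A \<noteq> Pt C\<rbrakk> \<Longrightarrow> {f \<in> Arr C. Dom C f = A \<and> Cod C f = Pt C} = {}"
    and Cov_Obj: "(A, M) \<in> Cov C \<Longrightarrow> A \<in> Obj C"
    and Cov_Arr: "\<lbrakk>(A, M) \<in> Cov C; f \<in># M\<rbrakk> \<Longrightarrow> f \<in> Arr C \<and> Cod C f = A"
    and Cov_Pt: "(Pt C, replicate_mset k (Id C (Pt C))) \<in> Cov C"
    and Cov_Id: "A \<in> Obj C \<Longrightarrow> (A, {#Id C A#}) \<in> Cov C"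
    \<comment> \<open>\<open>N\<close> lists the members \<open>g\<close> of the outer family together with a covering family of
      the domain of each; equal members may be paired with different families.\<close>
    and Cov_Comp: "\<lbrakk>(A, image_mset fst N) \<in> Cov C; \<And>g F. (g, F) \<in># N \<Longrightarrow> (Dom C g, F) \<in> Cov C\<rbrakk>
      \<Longrightarrow> (A, \<Sum>\<^sub># {#image_mset (Comp C g) F. (g, F) \<in># N#}) \<in> Cov C"

definition K0_relations :: "('o, 'm) cov_cat \<Rightarrow> ('o \<Rightarrow>\<^sub>0 int) set"
  where "K0_relations C =
    {frag_of A - (\<Sum>f\<in>#M. frag_of (Dom C f)) | A M. (A, M) \<in> Cov C}"

definition K0_kernel :: "('o, 'm) cov_cat \<Rightarrow> ('o \<Rightarrow>\<^sub>0 int) set"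
  where "K0_kernel C = generate (free_Abelian_group (Obj C)) (K0_relations C)"

definition K0 :: "('o, 'm) cov_cat \<Rightarrow> ('o \<Rightarrow>\<^sub>0 int) set monoid"
  where "K0 C = free_Abelian_group (Obj C) Mod K0_kernel C"

definition K0_class :: "('o, 'm) cov_cat \<Rightarrow> 'o \<Rightarrow> ('o \<Rightarrow>\<^sub>0 int) set"
  where "K0_class C A = K0_kernel C #>\<^bsub>free_Abelian_group (Obj C)\<^esub> frag_of A"


section \<open>The category \<open>\<Gamma>\<^bsub>n,n-1\<^esub>\<close>\<close>

definition Gamma_Obj :: "nat \<Rightarrow> ('v, 'e) graph set"
  where "Gamma_Obj n = graphs_with n \<union> graphs_with (n - 1) \<union> {empty_graph}"

definition Gamma_Cov :: "nat \<Rightarrow> (('v, 'e) graph \<times> ('v, 'e) morph multiset) set"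
  where "Gamma_Cov n =
    {(empty_graph, replicate_mset k (id_morph empty_graph)) | k. True} \<union>
    {(tgt f, {#f#}) | f. is_graph_iso f \<and> src f \<in> Gamma_Obj n \<and> tgt f \<in> Gamma_Obj n} \<union>
    {(G, {#comp_morph (deletion_inclusion G e) (g e). e \<in># mset_set (edges G)#}) | G g.
       G \<in> graphs_with n \<and> (\<forall>e \<in> edges G. is_graph_iso (g e) \<and> tgt (g e) = delete_edge G e)}"

definition Gamma :: "nat \<Rightarrow> (('v, 'e) graph, ('v, 'e) morph) cov_cat"
  where "Gamma n = \<lparr>Obj = Gamma_Obj n,
    Arr = {f. is_morph f \<and> src f \<in> Gamma_Obj n \<and> tgt f \<in> Gamma_Obj n},
    Dom = src, Cod = tgt, Id = id_morph, Comp = comp_morph,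
    Pt = empty_graph, Cov = Gamma_Cov n\<rparr>"

text \<open>\<open>the_elem\<close> picks the common value of \<open>K0_class\<close> on an isomorphism class of graphs;
  see \<open>iota_iso_class\<close> below.\<close>

definition iota :: "nat \<Rightarrow> ('v, 'e) graph set \<Rightarrow> (('v, 'e) graph \<Rightarrow>\<^sub>0 int) set"
  where "iota n X = the_elem (K0_class (Gamma n) ` X)"


section \<open>\<open>\<Gamma>\<^bsub>n,n-1\<^esub>\<close> is a category with covering families\<close>

lemma is_graph_empty: "is_graph empty_graph"
  by (auto simp: is_graph_def empty_graph_def)

lemma is_graph_no_verts: "\<lbrakk>is_graph G; verts G = {}\<rbrakk> \<Longrightarrow> G = empty_graph"
proof -
  assume G: "is_graph G" and V: "verts G = {}"
  have "edges G = {}"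
    using G V by (auto simp: is_graph_def Pairs_def PiE_iff)
  then show ?thesis
    using G V by (cases G) (auto simp: is_graph_def empty_graph_def PiE_iff extensional_def)
qed

lemma is_graph_delete_edge:
  assumes "is_graph G" shows "is_graph (delete_edge G e)"
  using assms by (auto simp: is_graph_def delete_edge_def PiE_iff inj_on_def)

lemma delete_edge_graphs_with:
  "\<lbrakk>G \<in> graphs_with n; e \<in> edges G\<rbrakk> \<Longrightarrow> delete_edge G e \<in> graphs_with (n - 1)"
  by (auto simp: graphs_with_def is_graph_delete_edge) (auto simp: delete_edge_def is_graph_def)

lemma is_morph_id: "is_graph G \<Longrightarrow> is_morph (id_morph G)"
proof -
  assume G: "is_graph G"
  have "(\<lambda>v\<in>verts G. v) ` ends G e = ends G e" if "e \<in> edges G" for e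
  proof -
    have "ends G e \<subseteq> verts G"
      using G that by (auto simp: is_graph_def Pairs_def PiE_iff)
    then have "(\<lambda>v\<in>verts G. v) ` ends G e = (\<lambda>v. v) ` ends G e"
      by (intro image_cong) auto
    then show ?thesis by simp
  qed
  then show ?thesis
    using G by (auto simp: is_morph_def id_morph_def inj_on_def)
qed

lemma src_tgt_id_morph: "src (id_morph G) = G" "tgt (id_morph G) = G"
  by (simp_all add: id_morph_def)

lemma src_tgt_comp_morph: "src (comp_morph g f) = src f" "tgt (comp_morph g f) = tgt g"
  by (simp_all add: comp_morph_def)

lemma ends_subset: "\<lbrakk>is_graph G; e \<in> edges G\<rbrakk> \<Longrightarrow> ends G e \<subseteq> verts G"
  by (auto simp: is_graph_def Pairs_def PiE_iff)

lemma ends_nonempty: "\<lbrakk>is_graph G; e \<in> edges G\<rbrakk> \<Longrightarrow> ends G e \<noteq> {}"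
  by (force simp: is_graph_def Pairs_def PiE_iff)

lemma is_morph_comp:
  assumes f: "is_morph f" and g: "is_morph g" and eq: "tgt f = src g"
  shows "is_morph (comp_morph g f)"
proof -
  have "ends (tgt g) (emap g (emap f e)) = compose (verts (src f)) (vmap g) (vmap f) ` ends (src f) e"
    if e: "e \<in> edges (src f)" for e
  proof -
    have fe: "emap f e \<in> edges (src g)"
      using f e eq by (auto simp: is_morph_def)
    have "ends (tgt g) (emap g (emap f e)) = vmap g ` vmap f ` ends (src f) e"
      using f g fe e eq by (simp add: is_morph_def)
    also have "\<dots> = (\<lambda>x. vmap g (vmap f x)) ` ends (src f) e"
      by (simp add: image_image)
    also have "\<dots> = compose (verts (src f)) (vmap g) (vmap f) ` ends (src f) e"
      using ends_subset[OF _ e] f by (intro image_cong) (auto simp: compose_def is_morph_def)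
    finally show ?thesis .
  qed
  moreover have "inj_on (compose (verts (src f)) (vmap g) (vmap f)) (verts (src f))"
    using f g eq by (auto simp: is_morph_def inj_on_def compose_def PiE_iff Pi_iff)
  moreover have "inj_on (compose (edges (src f)) (emap g) (emap f)) (edges (src f))"
    using f g eq by (auto simp: is_morph_def inj_on_def compose_def PiE_iff Pi_iff)
  ultimately show ?thesis
    using f g eq by (auto simp: is_morph_def comp_morph_def compose_def PiE_iff)
qed

lemma comp_morph_id_left: "is_morph f \<Longrightarrow> comp_morph (id_morph (tgt f)) f = f"
  by (cases f)
     (auto simp: comp_morph_def id_morph_def is_morph_def compose_def PiE_iff extensional_def
       fun_eq_iff)

lemma comp_morph_id_right: "is_morph f \<Longrightarrow> comp_morph f (id_morph (src f)) = f"
  by (cases f)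
     (auto simp: comp_morph_def id_morph_def is_morph_def compose_def PiE_iff extensional_def
       fun_eq_iff)

lemma comp_morph_assoc:
  "\<lbrakk>is_morph f; tgt f = src g\<rbrakk>
    \<Longrightarrow> comp_morph h (comp_morph g f) = comp_morph (comp_morph h g) f"
  by (auto simp: comp_morph_def is_morph_def compose_def PiE_iff fun_eq_iff)

lemma is_graph_iso_iff:
  "is_graph_iso f \<longleftrightarrow> is_morph f \<and> vmap f ` verts (src f) = verts (tgt f) \<and>
    emap f ` edges (src f) = edges (tgt f)"
proof (intro iffI conjI)
  assume "is_graph_iso f"
  then obtain g where f: "is_morph f" and g: "is_morph g" "src g = tgt f" "tgt g = src f"
    and fg: "comp_morph f g = id_morph (tgt f)"
    by (auto simp: is_graph_iso_def)
  show "is_morph f" by (rule f)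
  have v: "compose (verts (tgt f)) (vmap f) (vmap g) = (\<lambda>v\<in>verts (tgt f). v)"
    and e: "compose (edges (tgt f)) (emap f) (emap g) = (\<lambda>v\<in>edges (tgt f). v)"
    using fg g by (auto simp: comp_morph_def id_morph_def)
  have v': "vmap f (vmap g x) = x" "vmap g x \<in> verts (src f)" if "x \<in> verts (tgt f)" for x
    using fun_cong[OF v, of x] that g by (auto simp: compose_def is_morph_def)
  have e': "emap f (emap g x) = x" "emap g x \<in> edges (src f)" if "x \<in> edges (tgt f)" for x
    using fun_cong[OF e, of x] that g by (auto simp: compose_def is_morph_def)
  show "vmap f ` verts (src f) = verts (tgt f)"
  proof (intro subset_antisym subsetI)
    show "x \<in> vmap f ` verts (src f)" if "x \<in> verts (tgt f)" for x
      by (rule image_eqI[of _ _ "vmap g x"]) (use v'[OF that] in auto)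
  qed (use f in \<open>auto simp: is_morph_def\<close>)
  show "emap f ` edges (src f) = edges (tgt f)"
  proof (intro subset_antisym subsetI)
    show "x \<in> emap f ` edges (src f)" if "x \<in> edges (tgt f)" for x
      by (rule image_eqI[of _ _ "emap g x"]) (use e'[OF that] in auto)
  qed (use f in \<open>auto simp: is_morph_def\<close>)
next
  assume "is_morph f \<and> vmap f ` verts (src f) = verts (tgt f) \<and>
    emap f ` edges (src f) = edges (tgt f)"
  then have f: "is_morph f" and V: "vmap f ` verts (src f) = verts (tgt f)"
    and E: "emap f ` edges (src f) = edges (tgt f)" by auto
  let ?iv = "inv_into (verts (src f)) (vmap f)" and ?ie = "inv_into (edges (src f)) (emap f)"
  define g where "g = \<lparr>src = tgt f, tgt = src f,
    vmap = restrict ?iv (verts (tgt f)), emap = restrict ?ie (edges (tgt f))\<rparr>"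
  have injV: "inj_on (vmap f) (verts (src f))" and injE: "inj_on (emap f) (edges (src f))"
    using f by (auto simp: is_morph_def)
  have bv: "bij_betw ?iv (verts (tgt f)) (verts (src f))"
    and be: "bij_betw ?ie (edges (tgt f)) (edges (src f))"
    using injV injE V E by (auto intro!: bij_betw_inv_into simp: bij_betw_def[of "vmap f"] bij_betw_def[of "emap f"])
  have ends: "ends (src f) (?ie e) = restrict ?iv (verts (tgt f)) ` ends (tgt f) e"
    if e: "e \<in> edges (tgt f)" for e
  proof -
    obtain d where d: "d \<in> edges (src f)" "e = emap f d" using e E by auto
    have sub: "ends (src f) d \<subseteq> verts (src f)"
      using ends_subset[OF _ d(1)] f by (simp add: is_morph_def)
    have "restrict ?iv (verts (tgt f)) ` ends (tgt f) e
        = restrict ?iv (verts (tgt f)) ` vmap f ` ends (src f) d"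
      using f d by (auto simp: is_morph_def)
    also have "\<dots> = (\<lambda>x. x) ` ends (src f) d"
      unfolding image_image using sub V injV by (intro image_cong) (auto simp: inv_into_f_f)
    finally show ?thesis using d injE by simp
  qed
  have "is_morph g"
    using f bv be ends
    by (auto simp: is_morph_def g_def bij_betw_def inj_on_def)
  moreover have "comp_morph g f = id_morph (src f)"
    using V E injV injE by (auto simp: comp_morph_def g_def id_morph_def compose_def fun_eq_iff)
  moreover have "comp_morph f g = id_morph (tgt f)"
    using V E by (auto simp: comp_morph_def g_def id_morph_def compose_def fun_eq_iff f_inv_into_f)
  ultimately show "is_graph_iso f"
    using f unfolding is_graph_iso_def by (intro conjI exI[of _ g]) (auto simp: g_def)
qed

lemma is_graph_iso_id: "is_graph G \<Longrightarrow> is_graph_iso (id_morph G)"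
  using is_morph_id[of G] by (auto simp: is_graph_iso_iff) (auto simp: id_morph_def)

lemma image_compose_eq: "compose A h k ` A = h ` k ` A"
  by (force simp: compose_def)

lemma is_graph_iso_comp:
  assumes "is_graph_iso f" "is_graph_iso g" "tgt f = src g"
  shows "is_graph_iso (comp_morph g f)"
proof -
  have "is_morph (comp_morph g f)"
    using assms by (intro is_morph_comp) (auto simp: is_graph_iso_iff)
  then show ?thesis
    using assms by (simp add: is_graph_iso_iff) (simp add: comp_morph_def image_compose_eq)
qed

lemma is_graph_iso_card_edges: "is_graph_iso f \<Longrightarrow> card (edges (src f)) = card (edges (tgt f))"
  by (metis card_image is_graph_iso_iff is_morph_def)

lemma is_graph_iso_graphs_with: "is_graph_iso f \<Longrightarrow> src f \<in> graphs_with n \<longleftrightarrow> tgt f \<in> graphs_with n"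
  by (auto simp: graphs_with_def is_graph_iso_card_edges) (auto simp: is_graph_iso_def is_morph_def)

lemma is_morph_deletion_inclusion:
  assumes "is_graph G" shows "is_morph (deletion_inclusion G e)"
proof -
  have "(\<lambda>v\<in>verts G. v) ` ends G d = ends G d" if "d \<in> edges G" for d
    proof -
    have "(\<lambda>v\<in>verts G. v) ` ends G d = (\<lambda>v. v) ` ends G d"
      using ends_subset[OF assms that] by (intro image_cong) auto
    then show ?thesis by simp
  qed
  then show ?thesis
    using assms is_graph_delete_edge[OF assms]
    by (auto simp: is_morph_def deletion_inclusion_def) (auto simp: delete_edge_def inj_on_def)
qed

lemma morph_into_empty:
  assumes "is_morph f" "tgt f = empty_graph"
  shows "f = id_morph empty_graph"
proof -
  have "src f = empty_graph"
    using assms by (intro is_graph_no_verts) (auto simp: is_morph_def empty_graph_def)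
  moreover have "vmap f = (\<lambda>_. undefined)" "emap f = (\<lambda>_. undefined)"
    using assms calculation by (auto simp: is_morph_def empty_graph_def)
  ultimately show ?thesis
    using assms by (cases f) (auto simp: id_morph_def empty_graph_def)
qed

lemma empty_graph_not_in_graphs_with: "n \<ge> 1 \<Longrightarrow> empty_graph \<notin> graphs_with n"
  by (auto simp: graphs_with_def empty_graph_def)

lemma Gamma_Obj_is_graph: "G \<in> Gamma_Obj n \<Longrightarrow> is_graph G"
  by (auto simp: Gamma_Obj_def graphs_with_def is_graph_empty)

lemma Gamma_CovI_Pt: "(empty_graph, replicate_mset k (id_morph empty_graph)) \<in> Gamma_Cov n"
  by (auto simp: Gamma_Cov_def)

lemma Gamma_CovI_iso:
  "\<lbrakk>is_graph_iso f; src f \<in> Gamma_Obj n; tgt f \<in> Gamma_Obj n\<rbrakk> \<Longrightarrow> (tgt f, {#f#}) \<in> Gamma_Cov n"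
  by (auto simp: Gamma_Cov_def)

lemma Gamma_CovI_deck:
  assumes "G \<in> graphs_with n"
    and "\<And>e. e \<in> edges G \<Longrightarrow> is_graph_iso (g e) \<and> tgt (g e) = delete_edge G e"
  shows "(G, {#comp_morph (deletion_inclusion G e) (g e). e \<in># mset_set (edges G)#}) \<in> Gamma_Cov n"
  using assms unfolding Gamma_Cov_def by blast

lemma Gamma_CovE:
  assumes "(A, M) \<in> Gamma_Cov n"
  obtains k where "A = empty_graph" "M = replicate_mset k (id_morph empty_graph)"
  | f where "A = tgt f" "M = {#f#}" "is_graph_iso f" "src f \<in> Gamma_Obj n" "tgt f \<in> Gamma_Obj n"
  | g where "A \<in> graphs_with n"
      "M = {#comp_morph (deletion_inclusion A e) (g e). e \<in># mset_set (edges A)#}"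
      "\<And>e. e \<in> edges A \<Longrightarrow> is_graph_iso (g e) \<and> tgt (g e) = delete_edge A e"
  using assms unfolding Gamma_Cov_def by blast

lemma deck_family_morph:
  assumes "G \<in> graphs_with n" "e \<in> edges G" "is_graph_iso g" "tgt g = delete_edge G e"
  shows "is_morph (comp_morph (deletion_inclusion G e) g)"
    and "src g \<in> graphs_with (n - 1)"
    and "src g \<noteq> empty_graph"
proof -
  have G: "is_graph G" using assms by (simp add: graphs_with_def)
  show "is_morph (comp_morph (deletion_inclusion G e) g)"
    using is_morph_deletion_inclusion[OF G] assms
    by (intro is_morph_comp) (auto simp: is_graph_iso_def deletion_inclusion_def)
  show "src g \<in> graphs_with (n - 1)"
    using is_graph_iso_graphs_with[OF assms(3)] delete_edge_graphs_with[OF assms(1,2)] assms(4) by simp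
  have "verts G \<noteq> {}"
    using ends_nonempty[OF G assms(2)] ends_subset[OF G assms(2)] by auto
  then show "src g \<noteq> empty_graph"
    using assms(3,4) by (auto simp: is_graph_iso_iff delete_edge_def empty_graph_def)
qed

lemma iso_restrict_delete_edge:
  assumes f: "is_graph_iso f" and e: "e \<in> edges (src f)"
  defines "h \<equiv> \<lparr>src = delete_edge (src f) e, tgt = delete_edge (tgt f) (emap f e),
    vmap = vmap f, emap = restrict (emap f) (edges (src f) - {e})\<rparr>"
  shows "is_graph_iso h"
    and "comp_morph f (deletion_inclusion (src f) e)
      = comp_morph (deletion_inclusion (tgt f) (emap f e)) h"
proof -
  have m: "is_morph f" and V: "vmap f ` verts (src f) = verts (tgt f)"
    and E: "emap f ` edges (src f) = edges (tgt f)"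
    using f by (auto simp: is_graph_iso_iff)
  have inj: "inj_on (emap f) (edges (src f))" using m by (simp add: is_morph_def)
  have E': "emap f ` (edges (src f) - {e}) = edges (tgt f) - {emap f e}"
    using inj_on_image_set_diff[OF inj, of "edges (src f)" "{e}"] e E by auto
  have ne: "emap f x \<noteq> emap f e" if "x \<in> edges (src f)" "x \<noteq> e" for x
    using inj e that by (auto simp: inj_on_def)
  have "is_morph h"
    unfolding is_morph_def
  proof (intro conjI ballI)
    fix d assume "d \<in> edges (src h)"
    then have d: "d \<in> edges (src f)" "d \<noteq> e" by (auto simp: h_def delete_edge_def)
    then have "emap f d \<in> edges (tgt f) - {emap f e}" using E' by blast
    then show "ends (tgt h) (emap h d) = vmap h ` ends (src h) d"
      using d m by (simp add: h_def delete_edge_def is_morph_def)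
  next
    show "emap h \<in> edges (src h) \<rightarrow>\<^sub>E edges (tgt h)"
      using E' by (auto simp: h_def delete_edge_def)
    show "inj_on (emap h) (edges (src h))"
      using inj by (auto simp: h_def delete_edge_def inj_on_def)
    show "is_graph (src h)" "is_graph (tgt h)"
      using m by (simp_all add: h_def is_morph_def is_graph_delete_edge)
    show "vmap h \<in> verts (src h) \<rightarrow>\<^sub>E verts (tgt h)" "inj_on (vmap h) (verts (src h))"
      using m by (simp_all add: h_def is_morph_def delete_edge_def)
  qed
  then show "is_graph_iso h"
    using V E' by (simp add: is_graph_iso_iff) (simp add: h_def delete_edge_def)
  show "comp_morph f (deletion_inclusion (src f) e)
      = comp_morph (deletion_inclusion (tgt f) (emap f e)) h"
    using V E E' m ne by (auto simp: comp_morph_def deletion_inclusion_def h_def delete_edge_def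
      compose_def fun_eq_iff is_morph_def PiE_iff)
qed

lemma image_mset_eq_image_mset_set:
  assumes "finite E" "image_mset f N = image_mset g (mset_set E)"
  shows "\<exists>h. N = image_mset h (mset_set E) \<and> (\<forall>e\<in>E. f (h e) = g e)"
  using assms
proof (induction E arbitrary: N rule: finite_induct)
  case empty
  then show ?case by auto
next
  case (insert x E)
  then have "image_mset f N = add_mset (g x) (image_mset g (mset_set E))" by simp
  from msed_map_invR[OF this] obtain N' a where N': "N = add_mset a N'" "f a = g x"
    "image_mset f N' = image_mset g (mset_set E)" by blast
  then obtain h where h: "N' = image_mset h (mset_set E)" "\<forall>e\<in>E. f (h e) = g e"
    using insert.IH by blast
  have "image_mset (h(x := a)) (mset_set E) = image_mset h (mset_set E)"
    using insert.hyps by (intro image_mset_cong) auto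
  then have "N = image_mset (h(x := a)) (mset_set (insert x E))"
    using insert.hyps N' h by simp
  moreover have "\<forall>e\<in>insert x E. f ((h(x := a)) e) = g e"
    using N' h insert.hyps by auto
  ultimately show ?case by blast
qed

lemma sum_mset_singletons: "(\<Sum>\<^sub># {#{#h x#}. x \<in># M#}) = image_mset h M"
  by (induction M) auto

lemma Gamma_Cov_comp:
  assumes n: "n \<ge> 1" and A: "(A, image_mset fst N) \<in> Gamma_Cov n"
    and N: "\<And>g F. (g, F) \<in># N \<Longrightarrow> (src g, F) \<in> Gamma_Cov n"
  shows "(A, \<Sum>\<^sub># {#image_mset (comp_morph g) F. (g, F) \<in># N#}) \<in> Gamma_Cov n"
  using A
proof (cases rule: Gamma_CovE)
  case (1 k)
  let ?i = "id_morph empty_graph"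
  have comp: "comp_morph ?i ?i = ?i"
    using comp_morph_id_left[OF is_morph_id[OF is_graph_empty]] by (simp add: id_morph_def)
  have g: "g = ?i" "src g = empty_graph" if "(g, F) \<in># N" for g F
  proof -
    have "g \<in># image_mset fst N" using that by force
    then show "g = ?i" unfolding 1 by (simp split: if_splits)
    then show "src g = empty_graph" by (simp add: id_morph_def)
  qed
  have F: "set_mset F \<subseteq> {?i}" if gF: "(g, F) \<in># N" for g F
  proof -
    have "(empty_graph, F) \<in> Gamma_Cov n" using N[OF gF] g[OF gF] by simp
    then show ?thesis
    proof (cases rule: Gamma_CovE)
      case (2 f)
      then show ?thesis using morph_into_empty[of f] by (auto simp: is_graph_iso_def)
    next
      case (3 g)
      then show ?thesis using empty_graph_not_in_graphs_with[OF n] by blast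
    qed auto
  qed
  have "set_mset (\<Sum>\<^sub># {#image_mset (comp_morph g) F. (g, F) \<in># N#}) \<subseteq> {?i}"
  proof
    fix x assume "x \<in># (\<Sum>\<^sub># {#image_mset (comp_morph g) F. (g, F) \<in># N#})"
    then obtain g F y where gF: "(g, F) \<in># N" "y \<in># F" "x = comp_morph g y" by auto
    then have "y = ?i" using F[OF gF(1)] by auto
    then show "x \<in> {?i}" using g[OF gF(1)] gF comp by simp
  qed
  then have "(\<Sum>\<^sub># {#image_mset (comp_morph g) F. (g, F) \<in># N#})
      = replicate_mset (size (\<Sum>\<^sub># {#image_mset (comp_morph g) F. (g, F) \<in># N#})) ?i"
    by (rule set_mset_subset_singletonD)
  then show ?thesis using 1 Gamma_CovI_Pt by metis
next
  case (2 f)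
  from msed_map_invR[of fst N f "{#}"] 2 obtain F where NF: "N = {#(f, F)#}" by auto
  have F: "(src f, F) \<in> Gamma_Cov n" using N[of f F] NF by simp
  have "(tgt f, image_mset (comp_morph f) F) \<in> Gamma_Cov n"
    using F
  proof (cases rule: Gamma_CovE)
    case (1 k)
    have m: "is_morph f" using 2 by (simp add: is_graph_iso_def)
    have "verts (tgt f) = {}" using 1 \<open>is_graph_iso f\<close> by (auto simp: is_graph_iso_iff empty_graph_def)
    then have t: "tgt f = empty_graph" using m is_graph_no_verts by (auto simp: is_morph_def)
    have "comp_morph f (id_morph empty_graph) = id_morph empty_graph"
      using comp_morph_id_right[OF m] 1 morph_into_empty[OF m t] by simp
    then show ?thesis using 1 t Gamma_CovI_Pt by simp
  next
    case (2 g)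
    have "is_graph_iso (comp_morph f g)"
      using 2 \<open>is_graph_iso f\<close> by (intro is_graph_iso_comp) auto
    from Gamma_CovI_iso[OF this, of n] show ?thesis
      using 2 \<open>tgt f \<in> Gamma_Obj n\<close> by (simp add: comp_morph_def)
  next
    case (3 g)
    let ?E = "edges (src f)"
    define r where "r e = \<lparr>src = delete_edge (src f) e, tgt = delete_edge (tgt f) (emap f e),
      vmap = vmap f, emap = restrict (emap f) (?E - {e})\<rparr>" for e
    define g' where "g' d = (let e = inv_into ?E (emap f) d in comp_morph (r e) (g e))" for d
    have r: "is_graph_iso (r e)" "comp_morph f (deletion_inclusion (src f) e)
        = comp_morph (deletion_inclusion (tgt f) (emap f e)) (r e)" if "e \<in> ?E" for e
      using iso_restrict_delete_edge[OF \<open>is_graph_iso f\<close> that] by (simp_all add: r_def)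
    have inj: "inj_on (emap f) ?E" and im: "emap f ` ?E = edges (tgt f)"
      using \<open>is_graph_iso f\<close> by (auto simp: is_graph_iso_iff is_morph_def)
    have fin: "finite ?E" using 3 by (simp add: graphs_with_def is_graph_def)
    have g'_emap: "g' (emap f e) = comp_morph (r e) (g e)" if "e \<in> ?E" for e
      using that inj by (simp add: g'_def)
    have G: "tgt f \<in> graphs_with n" using 3 is_graph_iso_graphs_with[OF \<open>is_graph_iso f\<close>] by simp
    have g': "is_graph_iso (g' d) \<and> tgt (g' d) = delete_edge (tgt f) d" if d: "d \<in> edges (tgt f)" for d
    proof -
      obtain e where e: "e \<in> ?E" "d = emap f e" using d im by auto
      have "is_graph_iso (comp_morph (r e) (g e))"
        using r[OF e(1)] 3(3)[OF e(1)] by (intro is_graph_iso_comp) (auto simp: r_def)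
      then show ?thesis using g'_emap[OF e(1)] e by (simp add: comp_morph_def r_def)
    qed
    have eq: "comp_morph f (comp_morph (deletion_inclusion (src f) e) (g e))
        = comp_morph (deletion_inclusion (tgt f) (emap f e)) (g' (emap f e))" if e: "e \<in> ?E" for e
    proof -
      have ge: "is_morph (g e)" "tgt (g e) = delete_edge (src f) e"
        using 3(3)[OF e] by (auto simp: is_graph_iso_def)
      have "comp_morph f (comp_morph (deletion_inclusion (src f) e) (g e))
          = comp_morph (comp_morph f (deletion_inclusion (src f) e)) (g e)"
        using ge by (intro comp_morph_assoc) (auto simp: deletion_inclusion_def)
      also have "\<dots> = comp_morph (comp_morph (deletion_inclusion (tgt f) (emap f e)) (r e)) (g e)"
        using r[OF e] by simp
      also have "\<dots> = comp_morph (deletion_inclusion (tgt f) (emap f e)) (comp_morph (r e) (g e))"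
        using ge by (intro comp_morph_assoc[symmetric]) (auto simp: r_def)
      finally show ?thesis using g'_emap[OF e] by simp
    qed
    have "image_mset (comp_morph f) F
        = {#comp_morph (deletion_inclusion (tgt f) (emap f e)) (g' (emap f e)). e \<in># mset_set ?E#}"
      unfolding 3(2) multiset.map_comp o_def using fin eq by (intro image_mset_cong) auto
    also have "\<dots> = {#comp_morph (deletion_inclusion (tgt f) d) (g' d).
        d \<in># image_mset (emap f) (mset_set ?E)#}"
      by (simp add: multiset.map_comp o_def)
    also have "image_mset (emap f) (mset_set ?E) = mset_set (edges (tgt f))"
      using image_mset_mset_set[OF inj] im by simp
    finally show ?thesis using Gamma_CovI_deck[OF G g'] by simp
  qed
  then show ?thesis using 2 NF by simp
next
  case (3 g)
  have fin: "finite (edges A)" using 3 by (simp add: graphs_with_def is_graph_def)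
  obtain h where h: "N = image_mset h (mset_set (edges A))"
    "\<forall>e\<in>edges A. fst (h e) = comp_morph (deletion_inclusion A e) (g e)"
    using image_mset_eq_image_mset_set[OF fin 3(2)] by blast
  have ex: "\<exists>k. snd (h e) = {#k#} \<and> is_graph_iso k \<and> tgt k = src (g e)" if e: "e \<in> edges A" for e
  proof -
    have "h e \<in># N" using h(1) e fin by auto
    then have "(src (fst (h e)), snd (h e)) \<in> Gamma_Cov n"
      using N[of "fst (h e)" "snd (h e)"] by simp
    then have "(src (g e), snd (h e)) \<in> Gamma_Cov n"
      using h(2) e by (simp add: comp_morph_def)
    moreover have "src (g e) \<noteq> empty_graph" "src (g e) \<in> graphs_with (n - 1)"
      using deck_family_morph[OF 3(1) e] 3(3)[OF e] by auto
    moreover have "src (g e) \<notin> graphs_with n"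
      using calculation(3) n by (auto simp: graphs_with_def)
    ultimately show ?thesis by (auto elim: Gamma_CovE)
  qed
  obtain k where k: "\<And>e. e \<in> edges A \<Longrightarrow> snd (h e) = {#k e#} \<and> is_graph_iso (k e) \<and> tgt (k e) = src (g e)"
    using ex by metis
  have "(\<Sum>\<^sub># {#image_mset (comp_morph g) F. (g, F) \<in># N#})
      = (\<Sum>\<^sub># {#image_mset (comp_morph (fst (h e))) (snd (h e)). e \<in># mset_set (edges A)#})"
    unfolding h(1) by (simp add: multiset.map_comp o_def case_prod_beta)
  also have "\<dots> = (\<Sum>\<^sub># {#{#comp_morph (deletion_inclusion A e) (comp_morph (g e) (k e))#}.
      e \<in># mset_set (edges A)#})"
  proof (intro arg_cong[of _ _ sum_mset] image_mset_cong)
    fix e assume "e \<in># mset_set (edges A)"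
    then have e: "e \<in> edges A" using fin by simp
    have "comp_morph (comp_morph (deletion_inclusion A e) (g e)) (k e)
        = comp_morph (deletion_inclusion A e) (comp_morph (g e) (k e))"
      using k[OF e] by (intro comp_morph_assoc[symmetric]) (auto simp: is_graph_iso_def)
    then show "image_mset (comp_morph (fst (h e))) (snd (h e))
        = {#comp_morph (deletion_inclusion A e) (comp_morph (g e) (k e))#}"
      using k[OF e] h(2) e by simp
  qed
  also have "\<dots> = {#comp_morph (deletion_inclusion A e) (comp_morph (g e) (k e)).
      e \<in># mset_set (edges A)#}"
    by (rule sum_mset_singletons)
  also have "(A, \<dots>) \<in> Gamma_Cov n"
  proof (rule Gamma_CovI_deck[OF 3(1)])
    fix e assume e: "e \<in> edges A"
    have "is_graph_iso (comp_morph (g e) (k e))"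
      using k[OF e] 3(3)[OF e] by (intro is_graph_iso_comp) auto
    then show "is_graph_iso (comp_morph (g e) (k e)) \<and> tgt (comp_morph (g e) (k e)) = delete_edge A e"
      using 3(3)[OF e] by (simp add: comp_morph_def)
  qed
  finally show ?thesis .
qed

lemma Gamma_Cov_obj_arr:
  assumes "(A, M) \<in> Gamma_Cov n"
  shows "A \<in> Gamma_Obj n"
    and "f \<in># M \<Longrightarrow> is_morph f \<and> src f \<in> Gamma_Obj n \<and> tgt f = A"
proof -
  show "A \<in> Gamma_Obj n"
    using assms by (cases rule: Gamma_CovE) (auto simp: Gamma_Obj_def)
  show "is_morph f \<and> src f \<in> Gamma_Obj n \<and> tgt f = A" if fM: "f \<in># M"
    using assms
  proof (cases rule: Gamma_CovE)
    case (1 k)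
    then have "f = id_morph empty_graph" using fM by (simp split: if_splits)
    then show ?thesis using 1 is_morph_id[OF is_graph_empty]
      by (simp add: Gamma_Obj_def src_tgt_id_morph)
  next
    case (2 g)
    then show ?thesis using fM by (simp add: is_graph_iso_def)
  next
    case (3 g)
    then have "finite (edges A)" by (simp add: graphs_with_def is_graph_def)
    then obtain e where e: "e \<in> edges A" "f = comp_morph (deletion_inclusion A e) (g e)"
      using fM 3 by auto
    then show ?thesis
      using deck_family_morph(1,2)[OF 3(1) e(1), of "g e"] 3(3)[OF e(1)]
      by (simp add: Gamma_Obj_def src_tgt_comp_morph) (simp add: deletion_inclusion_def)
  qed
qed

lemma category_with_covering_families_Gamma:
  assumes "n \<ge> 1"
  shows "category_with_covering_families (Gamma n)"
proof (unfold_locales, goal_cases)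
  case (12)
  then show ?case by (simp add: Gamma_def Gamma_Obj_def)
next
  case 13
  have "src (id_morph empty_graph) = empty_graph" "tgt (id_morph empty_graph) = empty_graph"
    by (simp_all add: id_morph_def)
  then show ?case
    using morph_into_empty is_morph_id[OF is_graph_empty]
    by (auto simp: Gamma_def Gamma_Obj_def)
next
  case (14 A)
  have "src f = empty_graph" if "is_morph f" "tgt f = empty_graph" for f :: "('a, 'b) morph"
    using morph_into_empty[OF that] by (simp add: id_morph_def)
  then show ?case using 14 by (auto simp: Gamma_def)
next
  case (15 A M)
  then show ?case using Gamma_Cov_obj_arr(1) by (auto simp: Gamma_def)
next
  case (16 A M f)
  then have "(A, M) \<in> Gamma_Cov n" by (simp add: Gamma_def)
  from Gamma_Cov_obj_arr[OF this] show ?case using 16 by (auto simp: Gamma_def)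
next
  case (17 k)
  show ?case using Gamma_CovI_Pt by (simp add: Gamma_def)
next
  case (18 A)
  then have A: "A \<in> Gamma_Obj n" by (simp add: Gamma_def)
  then show ?case
    using Gamma_CovI_iso[of "id_morph A" n] is_graph_iso_id[OF Gamma_Obj_is_graph[OF A]]
    by (simp add: Gamma_def src_tgt_id_morph)
next
  case (19 A N)
  then show ?case using Gamma_Cov_comp[OF assms, of A N] by (simp add: Gamma_def)
next
  case 11
  then show ?case by (simp add: Gamma_def comp_morph_assoc[symmetric])
qed (simp_all add: Gamma_def src_tgt_id_morph src_tgt_comp_morph is_morph_id Gamma_Obj_is_graph
    is_morph_comp comp_morph_id_left comp_morph_id_right)


section \<open>The group \<open>K\<^sub>0\<close> and the map \<open>\<iota>\<^sub>n\<close>\<close>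

context category_with_covering_families
begin

lemma sum_mset_in_free_Abelian_group:
  assumes "\<And>x. x \<in># M \<Longrightarrow> F x \<in> carrier (free_Abelian_group S)"
  shows "(\<Sum>x\<in>#M. F x) \<in> carrier (free_Abelian_group S)"
  using assms
proof (induction M)
  case (add x M)
  then have "F x \<otimes>\<^bsub>free_Abelian_group S\<^esub> (\<Sum>x\<in>#M. F x) \<in> carrier (free_Abelian_group S)"
    by (intro monoid.m_closed) (auto intro: group.is_monoid)
  then show ?case by simp
qed (simp add: free_Abelian_group_def)

lemma K0_relations_carrier: "K0_relations C \<subseteq> carrier (free_Abelian_group (Obj C))"
proof
  fix x assume "x \<in> K0_relations C"
  then obtain A M where x: "x = frag_of A - (\<Sum>f\<in>#M. frag_of (Dom C f))" "(A, M) \<in> Cov C"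
    by (auto simp: K0_relations_def)
  have "(\<Sum>f\<in>#M. frag_of (Dom C f)) \<in> carrier (free_Abelian_group (Obj C))"
    using Cov_Arr[OF x(2)] Dom_Obj by (intro sum_mset_in_free_Abelian_group) auto
  then show "x \<in> carrier (free_Abelian_group (Obj C))"
    using x Cov_Obj[OF x(2)] keys_diff[of "frag_of A" "\<Sum>f\<in>#M. frag_of (Dom C f)"]
    by (auto simp: free_Abelian_group_def)
qed

lemma K0_kernel_subgroup: "subgroup (K0_kernel C) (free_Abelian_group (Obj C))"
  unfolding K0_kernel_def by (intro group.generate_is_subgroup K0_relations_carrier) simp

lemma comm_group_K0: "comm_group (K0 C)"
  unfolding K0_def using K0_kernel_subgroup
  by (intro comm_group.abelian_FactGroup) (auto simp: abelian_free_Abelian_group)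

lemma K0_class_carrier: "A \<in> Obj C \<Longrightarrow> K0_class C A \<in> carrier (K0 C)"
  by (auto simp: K0_def K0_class_def carrier_FactGroup)

lemma K0_class_eqI:
  assumes "A \<in> Obj C" "B \<in> Obj C" "frag_of A - frag_of B \<in> K0_kernel C"
  shows "K0_class C A = K0_class C B"
proof -
  interpret F: group "free_Abelian_group (Obj C)" by simp
  have "frag_of A \<in> K0_class C B"
    unfolding K0_class_def r_coset_def using assms(3) by (auto intro!: bexI[rotated])
  then show ?thesis
    using F.repr_independence[of "frag_of A" "K0_kernel C" "frag_of B"] assms K0_kernel_subgroup
    unfolding K0_class_def by simp
qed

end

lemma K0_class_isomorphic:
  assumes "n \<ge> 1" "G \<in> graphs_with n" "isomorphic G H"
  shows "K0_class (Gamma n) G = K0_class (Gamma n) H"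
proof -
  interpret category_with_covering_families "Gamma n"
    by (rule category_with_covering_families_Gamma[OF assms(1)])
  obtain f where f: "is_graph_iso f" "src f = G" "tgt f = H"
    using assms(3) by (auto simp: isomorphic_def)
  have H: "H \<in> graphs_with n" using is_graph_iso_graphs_with[OF f(1)] f assms(2) by simp
  have "(H, {#f#}) \<in> Cov (Gamma n)"
    using Gamma_CovI_iso[OF f(1), of n] f H assms(2) by (simp add: Gamma_def Gamma_Obj_def)
  then have "frag_of H - frag_of G \<in> K0_relations (Gamma n)"
    using f unfolding K0_relations_def by (force simp: Gamma_def)
  then have "frag_of H - frag_of G \<in> K0_kernel (Gamma n)"
    unfolding K0_kernel_def by (rule generate.incl)
  then show ?thesis
    using K0_class_eqI[of H G] H assms(2) by (simp add: Gamma_def Gamma_Obj_def)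
qed

lemma isomorphic_refl: "is_graph G \<Longrightarrow> isomorphic G G"
  using is_graph_iso_id[of G] by (auto simp: isomorphic_def id_morph_def)

lemma iota_iso_class:
  assumes "n \<ge> 1" "G \<in> graphs_with n"
  shows "iota n (iso_class G) = K0_class (Gamma n) G"
proof -
  have "K0_class (Gamma n) ` iso_class G = {K0_class (Gamma n) G}"
  proof (intro subset_antisym subsetI)
    show "x \<in> {K0_class (Gamma n) G}" if "x \<in> K0_class (Gamma n) ` iso_class G" for x
      using that K0_class_isomorphic[OF assms] unfolding iso_class_def by auto
    have "G \<in> iso_class G"
      using isomorphic_refl[of G] assms by (simp add: iso_class_def graphs_with_def)
    then show "x \<in> K0_class (Gamma n) ` iso_class G" if "x \<in> {K0_class (Gamma n) G}" for x
      using that by blast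
  qed
  then show ?thesis by (simp add: iota_def)
qed

lemma iota_carrier:
  assumes "n \<ge> 1"
  shows "iota n \<in> iso_classes n \<rightarrow> carrier (K0 (Gamma n))"
proof -
  interpret category_with_covering_families "Gamma n"
    by (rule category_with_covering_families_Gamma[OF assms])
  show ?thesis
  proof
    fix X :: "('a, 'b) graph set"
    assume "X \<in> iso_classes n"
    then obtain G :: "('a, 'b) graph" where G: "G \<in> graphs_with n" "X = iso_class G"
      by (auto simp: iso_classes_def)
    then have "G \<in> Obj (Gamma n)" by (simp add: Gamma_def Gamma_Obj_def)
    then show "iota n X \<in> carrier (K0 (Gamma n))"
      using K0_class_carrier iota_iso_class[OF assms G(1)] G(2) by simp
  qed
qed

end

theory Submission
  imports Defs
begin

text \<open>The function sending a graph with \<open>n\<close> edges to its edge deck, a nonempty graph with \<open>n - 1\<close>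
  edges to its isomorphism class and \<open>\<emptyset>\<close> to \<open>0\<close>, with values in the free abelian group on
  isomorphism classes, is additive on covering families; hence graphs with equal classes in
  \<open>K\<^sub>0\<close> have equal decks. Conversely, fixing a representative of every isomorphism class, a graph with
  \<open>n\<close> edges is covered by the representatives of its cards, so its class in \<open>K\<^sub>0\<close> depends only on
  its deck. So \<open>\<iota>\<^sub>n\<close> identifies exactly the graphs with equal decks.\<close>

lemma isomorphic_sym: "isomorphic G H \<Longrightarrow> isomorphic H G"
  unfolding isomorphic_def is_graph_iso_def by metis

lemma isomorphic_trans:
  assumes "isomorphic G H" "isomorphic H K"
  shows "isomorphic G K"
proof -
  obtain f g where "is_graph_iso f" "src f = G" "tgt f = H" "is_graph_iso g" "src g = H" "tgt g = K"
    using assms by (auto simp: isomorphic_def)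
  then show ?thesis
    using is_graph_iso_comp[of f g] unfolding isomorphic_def
    by (intro exI[of _ "comp_morph g f"]) (simp add: src_tgt_comp_morph)
qed

lemma iso_class_eq_iff:
  assumes "is_graph H"
  shows "iso_class G = iso_class H \<longleftrightarrow> isomorphic G H"
  using isomorphic_refl[OF assms] isomorphic_sym isomorphic_trans
  unfolding iso_class_def by blast

lemma iso_class_src_eq_tgt: "is_graph_iso f \<Longrightarrow> iso_class (src f) = iso_class (tgt f)"
  by (subst iso_class_eq_iff) (auto simp: isomorphic_def is_graph_iso_def is_morph_def)

text \<open>An isomorphism restricts to an isomorphism from each card of the source to the card of
  the target at the image edge; its bijective edge map reindexes one deck as the other.\<close>

lemma edge_deck_src_eq_tgt:
  assumes f: "is_graph_iso f"
  shows "edge_deck (src f) = edge_deck (tgt f)"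
proof -
  let ?E = "edges (src f)"
  have "inj_on (emap f) ?E" "emap f ` ?E = edges (tgt f)"
    using f by (auto simp: is_graph_iso_iff is_morph_def)
  then have im: "mset_set (edges (tgt f)) = image_mset (emap f) (mset_set ?E)"
    by (simp add: image_mset_mset_set)
  have fin: "finite ?E" using f by (simp add: is_graph_iso_def is_morph_def is_graph_def)
  have "iso_class (delete_edge (src f) e) = iso_class (delete_edge (tgt f) (emap f e))"
    if "e \<in> ?E" for e
    using iso_class_src_eq_tgt[OF iso_restrict_delete_edge(1)[OF f that]] by simp
  then show ?thesis
    unfolding edge_deck_def im multiset.map_comp o_def using fin
    by (intro image_mset_cong) auto
qed

lemma lookup_sum_mset_frag_of:
  "poly_mapping.lookup (\<Sum>x\<in>#M. frag_of x) y = int (count M y)"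
  by (induction M) (auto simp: lookup_add)

text \<open>The coefficients of the formal sum are the multiplicities, so a deck can be recovered
  from its sum.\<close>

lemma sum_mset_frag_of_inject:
  "(\<Sum>x\<in>#M. frag_of x) = (\<Sum>x\<in>#N. frag_of x) \<longleftrightarrow> M = N"
  by (metis lookup_sum_mset_frag_of multiset_eqI of_nat_eq_iff)

lemma frag_extend_sum_mset:
  "frag_extend h (\<Sum>x\<in>#M. F x) = (\<Sum>x\<in>#M. frag_extend h (F x))"
  by (induction M) (auto simp: frag_extend_add)

context category_with_covering_families
begin

text \<open>Universal property of \<open>K0\<close>: additivity on covering families makes the
  homomorphism \<open>frag_extend h\<close> vanish on the generating relations, hence on the
  subgroup they generate.\<close>

lemma frag_extend_K0_kernel:
  assumes "\<And>A M. (A, M) \<in> Cov C \<Longrightarrow> h A = (\<Sum>f\<in>#M. h (Dom C f))"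
    and "x \<in> K0_kernel C"
  shows "frag_extend h x = 0"
  using assms(2) unfolding K0_kernel_def
proof (induction rule: generate.induct)
  case (incl x)
  then show ?case
    using assms(1) by (auto simp: K0_relations_def frag_extend_diff frag_extend_sum_mset)
next
  case (inv x)
  then have "frag_extend h x = 0"
    using assms(1) by (auto simp: K0_relations_def frag_extend_diff frag_extend_sum_mset)
  \<comment> \<open>Inverses in the free abelian group are known to be negatives only on its
    carrier.\<close>
  moreover have "Poly_Mapping.keys x \<subseteq> Obj C"
    using subsetD[OF K0_relations_carrier inv] by simp
  ultimately show ?case by (simp add: frag_extend_minus)
qed (auto simp: frag_extend_add)

lemma K0_class_eqD:
  fixes h :: "'o \<Rightarrow> 'a \<Rightarrow>\<^sub>0 int"
  assumes "\<And>A M. (A, M) \<in> Cov C \<Longrightarrow> h A = (\<Sum>f\<in>#M. h (Dom C f))"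
    and "K0_class C A = K0_class C B"
  shows "h A = h B"
proof -
  \<comment> \<open>Thus \<open>frag_of A\<close> lies in its own coset, and so by hypothesis in
    that of \<open>B\<close>.\<close>
  have "0 \<in> K0_kernel C"
    using subgroup.one_closed[OF K0_kernel_subgroup] by simp
  then have "frag_of A \<in> K0_class C A"
    unfolding K0_class_def r_coset_def by force
  then obtain k where k: "k \<in> K0_kernel C" "frag_of A = k + frag_of B"
    unfolding assms(2) by (auto simp: K0_class_def r_coset_def)
  have "frag_extend h (frag_of A) = frag_extend h (frag_of B)"
    unfolding k(2) using frag_extend_K0_kernel[OF assms(1) k(1)] by (simp add: frag_extend_add)
  then show ?thesis by simp
qed

text \<open>Both classes equal the same sum of generators. The domains must agree as objects, not
  just up to isomorphism, which is why representatives are chosen below.\<close>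

lemma K0_class_eq_Cov:
  assumes "(A, M) \<in> Cov C" "(B, N) \<in> Cov C" "image_mset (Dom C) M = image_mset (Dom C) N"
  shows "K0_class C A = K0_class C B"
proof (rule K0_class_eqI)
  let ?F = "free_Abelian_group (Obj C)"
  have rel: "frag_of A - (\<Sum>f\<in>#M. frag_of (Dom C f)) \<in> K0_kernel C"
    "frag_of B - (\<Sum>f\<in>#N. frag_of (Dom C f)) \<in> K0_kernel C"
    unfolding K0_kernel_def K0_relations_def using assms(1,2) by (auto intro!: generate.incl)
  have sum: "(\<Sum>f\<in>#M. frag_of (Dom C f)) = (\<Sum>f\<in>#N. frag_of (Dom C f))"
    using arg_cong[OF assms(3), of "image_mset frag_of"] by (simp add: multiset.map_comp o_def)
  have "x - y \<in> K0_kernel C" if "x \<in> K0_kernel C" "y \<in> K0_kernel C" for x y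
  proof -
    have "Poly_Mapping.keys y \<subseteq> Obj C"
      using subsetD[OF subgroup.subset[OF K0_kernel_subgroup] that(2)] by simp
    then show ?thesis
      using subgroup.m_closed[OF K0_kernel_subgroup that(1)
          subgroup.m_inv_closed[OF K0_kernel_subgroup that(2)]] by simp
  qed
  from this[OF rel] show "frag_of A - frag_of B \<in> K0_kernel C" by (simp add: sum)
qed (use assms Cov_Obj in auto)

end

text \<open>Covering families of type (iii) allow any isomorphisms onto the cards, so their sources
  can be prescribed by a function \<open>r\<close> of the isomorphism class alone.\<close>

lemma Gamma_Cov_representatives:
  assumes "G \<in> graphs_with n"
    and r: "\<And>e. e \<in> edges G \<Longrightarrow> isomorphic (r (iso_class (delete_edge G e))) (delete_edge G e)"
  shows "\<exists>M. (G, M) \<in> Gamma_Cov n \<and> image_mset src M = image_mset r (edge_deck G)"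
proof -
  obtain g where g: "\<And>e. e \<in> edges G \<Longrightarrow> is_graph_iso (g e) \<and>
      src (g e) = r (iso_class (delete_edge G e)) \<and> tgt (g e) = delete_edge G e"
    using r unfolding isomorphic_def by metis
  let ?M = "{#comp_morph (deletion_inclusion G e) (g e). e \<in># mset_set (edges G)#}"
  have "(G, ?M) \<in> Gamma_Cov n"
    using g by (intro Gamma_CovI_deck[OF assms(1)]) auto
  moreover have "image_mset src ?M = image_mset r (edge_deck G)"
    unfolding edge_deck_def multiset.map_comp o_def src_tgt_comp_morph
    using g assms(1) by (intro image_mset_cong) (auto simp: graphs_with_def is_graph_def)
  ultimately show ?thesis by blast
qed

lemma K0_class_eq_if_edge_deck_eq:
  fixes G G' :: "('v, 'e) graph"
  assumes n: "n \<ge> 1" and G: "G \<in> graphs_with n" and G': "G' \<in> graphs_with n"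
    and eq: "edge_deck G = edge_deck G'"
  shows "K0_class (Gamma n) G = K0_class (Gamma n) G'"
proof -
  interpret category_with_covering_families "Gamma n"
    by (rule category_with_covering_families_Gamma[OF n])
  \<comment> \<open>One choice per class: isomorphic cards of \<open>G\<close> and \<open>G'\<close>
    get literally the same source.\<close>
  define r where "r X = (SOME H. H \<in> X)" for X :: "('v, 'e) graph set"
  have r: "isomorphic (r (iso_class K)) K" if "is_graph K" for K :: "('v, 'e) graph"
  proof -
    have "K \<in> iso_class K"
      using isomorphic_refl[OF that] by (simp add: iso_class_def)
    then have "r (iso_class K) \<in> iso_class K" unfolding r_def by (rule someI)
    then show ?thesis by (auto simp: iso_class_def intro: isomorphic_sym)
  qed
  have *: "\<exists>M. (H, M) \<in> Gamma_Cov n \<and> image_mset src M = image_mset r (edge_deck H)"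
    if "H \<in> graphs_with n" for H :: "('v, 'e) graph"
    using that
    by (intro Gamma_Cov_representatives r is_graph_delete_edge) (auto simp: graphs_with_def)
  obtain M N where "(G, M) \<in> Gamma_Cov n" "(G', N) \<in> Gamma_Cov n"
    "image_mset src M = image_mset src N"
    using *[OF G] *[OF G'] eq by metis
  then show ?thesis
    by (intro K0_class_eq_Cov[of G M G' N]) (simp_all add: Gamma_def)
qed

text \<open>The empty graph is split off from the last case because for \<open>n = 1\<close> it also
  has \<open>n - 1\<close> edges, yet being covered by the empty family it must go to 0.\<close>

definition deck_invariant :: "nat \<Rightarrow> ('v, 'e) graph \<Rightarrow> ('v, 'e) graph set \<Rightarrow>\<^sub>0 int"
  where "deck_invariant n A =
    (if A \<in> graphs_with n then \<Sum>X\<in>#edge_deck A. frag_of X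
     else if A = empty_graph then 0 else frag_of (iso_class A))"

lemma deck_invariant_src_eq_tgt:
  assumes f: "is_graph_iso f"
  shows "deck_invariant n (src f) = deck_invariant n (tgt f)"
proof -
  have "is_graph (src f)" "is_graph (tgt f)"
    using f by (simp_all add: is_graph_iso_def is_morph_def)
  \<comment> \<open>A graph is empty exactly when it has no vertices, so isomorphisms respect the
    case split.\<close>
  moreover have "verts (src f) = {} \<longleftrightarrow> verts (tgt f) = {}"
    using f by (auto simp: is_graph_iso_iff)
  ultimately have "src f = empty_graph \<longleftrightarrow> tgt f = empty_graph"
    using is_graph_no_verts by (metis empty_graph_def graph.select_convs(1))
  then show ?thesis
    using iso_class_src_eq_tgt[OF f] edge_deck_src_eq_tgt[OF f] is_graph_iso_graphs_with[OF f]
    by (simp add: deck_invariant_def)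
qed

lemma deck_invariant_additive:
  fixes A :: "('v, 'e) graph"
  assumes n: "n \<ge> 1" and "(A, M) \<in> Gamma_Cov n"
  shows "deck_invariant n A = (\<Sum>f\<in>#M. deck_invariant n (src f))"
  using assms(2)
proof (cases rule: Gamma_CovE)
  case (1 k)
  have "deck_invariant n (empty_graph :: ('v, 'e) graph) = 0"
    by (simp add: deck_invariant_def empty_graph_not_in_graphs_with[OF n])
  then show ?thesis using 1 by (induction k arbitrary: M) (auto simp: src_tgt_id_morph)
next
  case (2 f)
  then show ?thesis by (simp add: deck_invariant_src_eq_tgt)
next
  case (3 g)
  have fin: "finite (edges A)" using 3 by (simp add: graphs_with_def is_graph_def)
  have card: "deck_invariant n (src (g e)) = frag_of (iso_class (delete_edge A e))"
    if e: "e \<in> edges A" for e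
  proof -
    have g: "is_graph_iso (g e)" "tgt (g e) = delete_edge A e" using 3(3)[OF e] by auto
    \<comment> \<open>A card keeps the endpoints of the deleted edge, so it is nonempty; since
      \<open>n - 1\<close> differs from \<open>n\<close> for \<open>n \<ge> 1\<close>, the last case
      of \<open>deck_invariant\<close> applies.\<close>
    have "src (g e) \<noteq> empty_graph" "src (g e) \<in> graphs_with (n - 1)"
      using deck_family_morph[OF 3(1) e g] by auto
    moreover from this have "src (g e) \<notin> graphs_with n"
      using n by (auto simp: graphs_with_def)
    ultimately show ?thesis
      using iso_class_src_eq_tgt[OF g(1)] g(2) by (simp add: deck_invariant_def)
  qed
  have "deck_invariant n A = (\<Sum>e\<in>#mset_set (edges A). frag_of (iso_class (delete_edge A e)))"
    using 3(1) by (simp add: deck_invariant_def edge_deck_def multiset.map_comp o_def)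
  also have "\<dots> = (\<Sum>e\<in>#mset_set (edges A). deck_invariant n (src (g e)))"
    using fin card by (intro arg_cong[of _ _ sum_mset] image_mset_cong) auto
  finally show ?thesis
    unfolding 3(2) by (simp add: multiset.map_comp o_def src_tgt_comp_morph)
qed

lemma edge_deck_eq_if_K0_class_eq:
  assumes n: "n \<ge> 1" and G: "G \<in> graphs_with n" and G': "G' \<in> graphs_with n"
    and eq: "K0_class (Gamma n) G = K0_class (Gamma n) G'"
  shows "edge_deck G = edge_deck G'"
proof -
  interpret category_with_covering_families "Gamma n"
    by (rule category_with_covering_families_Gamma[OF n])
  have "deck_invariant n G = deck_invariant n G'"
    using deck_invariant_additive[OF n] by (intro K0_class_eqD[OF _ eq]) (simp add: Gamma_def)
  then show ?thesis
    using G G' by (simp add: deck_invariant_def sum_mset_frag_of_inject)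
qed

theorem theorem1:
  fixes n :: nat
  assumes "n \<ge> 1"
  shows "(\<forall>G \<in> graphs_with n. \<forall>G' \<in> graphs_with n.
            edge_deck G = edge_deck (G' :: ('v::infinite, 'e::infinite) graph) \<longrightarrow> isomorphic G G')
         \<longleftrightarrow> inj_on (iota n) (iso_classes n :: ('v, 'e) graph set set)"
proof -
  have deck: "iota n (iso_class G) = iota n (iso_class G') \<longleftrightarrow> edge_deck G = edge_deck G'"
    and iso: "iso_class G = iso_class G' \<longleftrightarrow> isomorphic G G'"
    if "G \<in> graphs_with n" "G' \<in> graphs_with n" for G G' :: "('v, 'e) graph"
    using that iota_iso_class[OF assms] K0_class_eq_if_edge_deck_eq[OF assms that]
      edge_deck_eq_if_K0_class_eq[OF assms that] iso_class_eq_iff[of G' G]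
    by (auto simp: graphs_with_def)
  show ?thesis
    \<comment> \<open>Injectivity becomes a statement about pairs of graphs, where
      \<open>deck\<close> translates its hypothesis and \<open>iso\<close> its conclusion.\<close>
    unfolding iso_classes_def inj_on_def ball_simps using deck iso by auto
qed

end
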